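(* Let $\mathbf h^k$ be a feasible path flow vector, let $\mathbf p^k=\mathcal{P}(\mathcal{C}(\mathbf h^k))$ and $\mathcal{F}(\mathbf h^k)=\mathcal{L}(\mathbf h^k)-\mathbf h^k$. Every solution $\boldsymbol\delta^k\in\mathbb{R}^n$ of the reduced Newton system $$(\mathbf I-\mathcal{K}(\mathbf h^k))\,\boldsymbol\delta^k=\mathcal{F}(\mathbf h^k)$$ also solves the full Newton system $$\bigl(\mathcal{H}'_{\mathbf h}(\mathbf p^k)+\mathcal{K}(\mathbf h^k)-\mathbf I\bigr)\,\boldsymbol{\hat\delta}^k=-\mathcal{F}(\mathbf h^k),$$ i.e. the latter holds with $\boldsymbol{\hat\delta}^k=\boldsymbol\delta^k$.
   Context: Network setting. There is a finite set $\mathbb{L}$ of links and a finite nonempty set of origin-destination (OD) pairs. Each OD pair has a demand $d_{OD}\ge 0$ and a fixed finite nonempty set $\mathbb{P}_{OD}$ of acyclic paths; $\mathbb{P}$ is the disjoint union of the $\mathbb{P}_{OD}$, $n=|\mathbb{P}|$, and $OD(i)$ is the OD pair of path $i$. $\mathbf{D}\in\{0,1\}^{|\mathbb{L}|\times n}$ is the link-path incidence matrix ($D_{li}=1$ iff link $l$ is on path $i$). A vector $\mathbf{h}\in\mathbb{R}^n$ is a feasible path flow vector if $h_i\ge 0$ for all $i$ and $\sum_{i\in\mathbb{P}_{OD}}h_i=d_{OD}$ for every OD pair. Costs. The cost of link $l$ depends only on its own flow $a_l$ via $\tau_l:[0,\infty)\to[0,\infty)$, which is twice continuously differentiable and monotone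 non-decreasing, with $\tau_l'$ Lipschitz on the bounded set of link flows arising from feasible path flows. Link flows are $\mathbf a=\mathbf D\mathbf h$, path costs are $\mathcal{C}(\mathbf h)=\mathbf{D}^T\mathcal{T}(\mathbf{D}\mathbf{h})$ with $\mathcal{T}_l(\mathbf a)=\tau_l(a_l)$, and the Jacobian is $\mathcal{C}'(\mathbf h)=\mathbf D^T\operatorname{diag}(\tau_l'(a_l))\mathbf D$. Logit model. $\theta>0$ is a fixed parameter. For a path cost vector $\mathbf c$, $\mathcal{P}(\mathbf c)_i=\exp(-\theta c_i)/\sum_{i'\in\mathbb{P}_{OD(i)}}\exp(-\theta c_{i'})$. Put $\mathcal{H}(\mathbf h,\mathbf p)_i=\bigl(\sum_{i'\in\mathbb{P}_{OD(i)}}h_{i'}\bigr)p_i$. The logit mapping is $\mathcal{L}(\mathbf h)=\mathcal{H}(\mathbf h,\mathcal{P}(\mathcal{C}(\mathbf h)))$. $\mathcal{P}'(\mathbf c)$ is the Jacobian of $\mathcal{P}$; $\mathcal{H}'_{\mathbf h}(\mathbf p)$ is the Jacobian of $\mathcal{H}$ in $\mathbf h$ with $\mathbf p$ fixed (its $(i,j)$ entry is $p_i$ if $i,j$ belong to the same OD pair and $0$ otherwise); $\mathcal{H}'_{\mathbf p}(\mathbf h)$ is the Jacobian of $\mathcal{H}$ in $\mathbf p$ with $\mathbf h$ fixed (for feasible $\mathbf h$, the diagonal matrix with entries $d_{OD(i)}$). The reduced Jacobian is $\mathcal{K}(\mathbf h)=\mathcal{H}'_{\mathbf p}(\mathbf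 h)\,\mathcal{P}'(\mathbf c)\,\mathcal{C}'(\mathbf h)$ with $\mathbf c=\mathcal{C}(\mathbf h)$. *)

theory Defs
  imports "HOL-Analysis.Analysis" "Graph_Theory.Arc_Walk"
begin

text \<open>
  The links are the arcs of a digraph \<open>G\<close> and the OD pairs are a set \<open>W\<close> of node pairs. The disjoint
  union of the path sets \<open>paths w\<close>, \<open>w \<in> W\<close>, is enumerated by the finite type \<open>'p\<close>: index \<open>i\<close> stands
  for the path \<open>route i\<close> of the pair \<open>od i\<close>, so that vectors indexed by paths have type \<open>real ^ 'p\<close>.
  The function \<open>\<tau>' l\<close> is the derivative of \<open>\<tau> l\<close> on \<open>[0, \<infinity>)\<close>, one-sided at \<open>0\<close>.
\<close>

text \<open>
  The link set \<open>arcs G\<close> may be a proper subset of the type \<open>'l\<close> (in particular it may be empty); the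
  rows of the incidence matrix that do not belong to a link vanish, since paths only use links.
\<close>

definition incidence :: "('p::finite \<Rightarrow> 'l::finite list) \<Rightarrow> real ^ 'p ^ 'l" where
  "incidence route = (\<chi> l i. if l \<in> set (route i) then 1 else 0)"

definition feasible_flows ::
    "('v \<times> 'v) set \<Rightarrow> ('p::finite \<Rightarrow> 'v \<times> 'v) \<Rightarrow> ('v \<times> 'v \<Rightarrow> real) \<Rightarrow> (real ^ 'p) set" where
  "feasible_flows W od d =
     {h. (\<forall>i. 0 \<le> h $ i) \<and> (\<forall>w\<in>W. (\<Sum>i | od i = w. h $ i) = d w)}"

locale traffic_network = wf_digraph G
  for G :: "('v, 'l::finite) pre_digraph" (structure) +
  fixes W :: "('v \<times> 'v) set"
    and paths :: "'v \<times> 'v \<Rightarrow> 'l list set"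
    and od :: "'p::finite \<Rightarrow> 'v \<times> 'v"
    and route :: "'p \<Rightarrow> 'l list"
    and d :: "'v \<times> 'v \<Rightarrow> real"
    and \<tau> \<tau>' :: "'l \<Rightarrow> real \<Rightarrow> real"
  assumes finite_od: "finite W" and nonempty_od: "W \<noteq> {}"
    and finite_paths: "w \<in> W \<Longrightarrow> finite (paths w)"
    and nonempty_paths: "w \<in> W \<Longrightarrow> paths w \<noteq> {}"
    and acyclic_paths: "w \<in> W \<Longrightarrow> p \<in> paths w \<Longrightarrow> apath (fst w) p (snd w)"
    and enumeration: "bij_betw (\<lambda>i. (od i, route i)) UNIV (Sigma W paths)"
    and demand_nonneg: "w \<in> W \<Longrightarrow> 0 \<le> d w"
    and link_cost_nonneg: "l \<in> arcs G \<Longrightarrow> 0 \<le> x \<Longrightarrow> 0 \<le> \<tau> l x"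
    and link_cost_mono: "l \<in> arcs G \<Longrightarrow> mono_on {0..} (\<tau> l)"
    and link_cost_deriv:
      "l \<in> arcs G \<Longrightarrow> 0 \<le> x \<Longrightarrow> (\<tau> l has_real_derivative \<tau>' l x) (at x within {0..})"
    and link_cost_C2: "l \<in> arcs G \<Longrightarrow> \<exists>\<tau>''. continuous_on {0..} \<tau>'' \<and>
      (\<forall>x\<ge>0. (\<tau>' l has_real_derivative \<tau>'' x) (at x within {0..}))"
    and link_cost_deriv_lipschitz: "l \<in> arcs G \<Longrightarrow>
      \<exists>M. M-lipschitz_on ((\<lambda>h. (incidence route *v h) $ l) ` feasible_flows W od d) (\<tau>' l)"

definition link_cost :: "('l::finite \<Rightarrow> real \<Rightarrow> real) \<Rightarrow> real ^ 'l \<Rightarrow> real ^ 'l" where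
  "link_cost \<tau> a = (\<chi> l. \<tau> l (a $ l))"

definition path_cost ::
    "('p::finite \<Rightarrow> 'l::finite list) \<Rightarrow> ('l \<Rightarrow> real \<Rightarrow> real) \<Rightarrow> real ^ 'p \<Rightarrow> real ^ 'p" where
  "path_cost route \<tau> h = transpose (incidence route) *v link_cost \<tau> (incidence route *v h)"

text \<open>
  The Jacobian of the path cost map is given by its formula, because the map is only meaningful
  for nonnegative flows; see \<open>path_cost_has_derivative\<close> below.
\<close>

definition path_cost_jacobian ::
    "('p::finite \<Rightarrow> 'l::finite list) \<Rightarrow> ('l \<Rightarrow> real \<Rightarrow> real) \<Rightarrow> real ^ 'p \<Rightarrow> real ^ 'p ^ 'p" where
  "path_cost_jacobian route \<tau>' h =
     transpose (incidence route)
     ** (\<chi> k l. if k = l then \<tau>' l ((incidence route *v h) $ l) else 0)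
     ** incidence route"

definition logit_prob :: "('p::finite \<Rightarrow> 'w) \<Rightarrow> real \<Rightarrow> real ^ 'p \<Rightarrow> real ^ 'p" where
  "logit_prob od \<theta> c =
     (\<chi> i. exp (- \<theta> * c $ i) / (\<Sum>j | od j = od i. exp (- \<theta> * c $ j)))"

definition assignment :: "('p::finite \<Rightarrow> 'w) \<Rightarrow> real ^ 'p \<Rightarrow> real ^ 'p \<Rightarrow> real ^ 'p" where
  "assignment od h p = (\<chi> i. (\<Sum>j | od j = od i. h $ j) * p $ i)"

definition logit_map ::
    "('p::finite \<Rightarrow> 'w) \<Rightarrow> ('p \<Rightarrow> 'l::finite list) \<Rightarrow> ('l \<Rightarrow> real \<Rightarrow> real) \<Rightarrow> real \<Rightarrow> real ^ 'p \<Rightarrow> real ^ 'p" where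
  "logit_map od route \<tau> \<theta> h = assignment od h (logit_prob od \<theta> (path_cost route \<tau> h))"

definition assignment_jacobian_flow :: "('p::finite \<Rightarrow> 'w) \<Rightarrow> real ^ 'p \<Rightarrow> real ^ 'p \<Rightarrow> real ^ 'p ^ 'p" where
  "assignment_jacobian_flow od h p = jacobian (\<lambda>h'. assignment od h' p) (at h)"

definition assignment_jacobian_prob :: "('p::finite \<Rightarrow> 'w) \<Rightarrow> real ^ 'p \<Rightarrow> real ^ 'p \<Rightarrow> real ^ 'p ^ 'p" where
  "assignment_jacobian_prob od h p = jacobian (\<lambda>p'. assignment od h p') (at p)"

definition reduced_jacobian ::
    "('p::finite \<Rightarrow> 'w) \<Rightarrow> ('p \<Rightarrow> 'l::finite list) \<Rightarrow> ('l \<Rightarrow> real \<Rightarrow> real) \<Rightarrow> ('l \<Rightarrow> real \<Rightarrow> real) \<Rightarrow> real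
      \<Rightarrow> real ^ 'p \<Rightarrow> real ^ 'p ^ 'p" where
  "reduced_jacobian od route \<tau> \<tau>' \<theta> h =
     (let c = path_cost route \<tau> h
      in assignment_jacobian_prob od h (logit_prob od \<theta> c)
         ** jacobian (logit_prob od \<theta>) (at c)
         ** path_cost_jacobian route \<tau>' h)"

lemma assignment_jacobian_flow_entries:
  fixes od :: "'p::finite \<Rightarrow> 'w"
  shows "assignment_jacobian_flow od h p = (\<chi> i j. if od j = od i then p $ i else 0)"
proof -
  let ?A = "(\<chi> i j. if od j = od i then p $ i else 0) :: real^'p^'p"
  have "(\<Sum>j | od j = od i. h' $ j) * p $ i = (\<Sum>j\<in>UNIV. (if od j = od i then p $ i else 0) * h' $ j)"
    for h' :: "real^'p" and i
    unfolding sum_distrib_right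
    by (rule sum.mono_neutral_cong_left) (auto simp: mult.commute)
  then have eq: "(\<lambda>h'. assignment od h' p) = (\<lambda>h'. ?A *v h')"
    by (simp add: fun_eq_iff vec_eq_iff assignment_def matrix_vector_mult_def)
  have deriv: "((\<lambda>h'. ?A *v h') has_derivative (\<lambda>v. ?A *v v)) (at h)"
    by (rule bounded_linear_imp_has_derivative) (rule matrix_vector_mul_bounded_linear)
  show ?thesis
    by (simp only: assignment_jacobian_flow_def jacobian_def eq
        frechet_derivative_at[OF deriv, symmetric] matrix_of_matrix_vector_mul)
qed

lemma assignment_jacobian_prob_entries:
  fixes od :: "'p::finite \<Rightarrow> 'v \<times> 'v"
  assumes h: "h \<in> feasible_flows W od d" and od: "range od \<subseteq> W"
  shows "assignment_jacobian_prob od h p = (\<chi> i j. if i = j then d (od i) else 0)"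
proof -
  let ?A = "(\<chi> i j. if i = j then d (od i) else 0) :: real^'p^'p"
  have s: "(\<Sum>j | od j = od i. h $ j) = d (od i)" for i
    using h od by (auto simp: feasible_flows_def)
  have eq: "(\<lambda>p'. assignment od h p') = (\<lambda>p'. ?A *v p')"
    by (auto simp: fun_eq_iff vec_eq_iff assignment_def matrix_vector_mult_def s
        if_distrib[of "\<lambda>x. x * _"] cong: if_cong)
  have deriv: "((\<lambda>p'. ?A *v p') has_derivative (\<lambda>v. ?A *v v)) (at p)"
    by (rule bounded_linear_imp_has_derivative) (rule matrix_vector_mul_bounded_linear)
  show ?thesis
    by (simp only: assignment_jacobian_prob_def jacobian_def eq
        frechet_derivative_at[OF deriv, symmetric] matrix_of_matrix_vector_mul)
qed

lemma logit_prob_differentiable: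
  fixes od :: "'p::finite \<Rightarrow> 'w"
  shows "logit_prob od \<theta> differentiable (at c)"
proof -
  have pos: "(\<Sum>j | od j = od i. exp (- \<theta> * c $ j)) \<noteq> 0" for i
    by (rule less_imp_neq[symmetric], rule sum_pos) auto
  have e: "(\<lambda>c::real^'p. exp (- \<theta> * c $ i)) differentiable (at c)" for i
    by (rule differentiableI, rule has_derivative_exp, rule has_derivative_mult_right,
        rule bounded_linear_imp_has_derivative, rule bounded_linear_vec_nth)
  have q: "(\<lambda>c::real^'p. logit_prob od \<theta> c $ i) differentiable (at c)" for i
    unfolding logit_prob_def vec_lambda_beta
    by (intro differentiable_divide differentiable_sum e pos) (use e in simp_all)
  show ?thesis
    by (subst differentiable_componentwise_within) (auto simp: Basis_vec_def inner_axis q)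
qed

lemma (in traffic_network) path_cost_has_derivative:
  assumes h: "\<And>i. 0 \<le> h $ i"
  shows "(path_cost route \<tau> has_derivative (\<lambda>v. path_cost_jacobian route \<tau>' h *v v))
           (at h within {h. \<forall>i. 0 \<le> h $ i})"
proof -
  let ?D = "incidence route" and ?S = "{h::real^'p. \<forall>i. 0 \<le> h $ i}"
  have nonneg: "0 \<le> (?D *v x) $ l" if "x \<in> ?S" for x l
    using that by (auto simp: matrix_vector_mult_def incidence_def intro!: sum_nonneg)
  have link: "l \<in> arcs G" if "l \<in> set (route i)" for l i
  proof -
    have "od i \<in> W" "route i \<in> paths (od i)"
      using enumeration by (auto simp: bij_betw_def)
    then show ?thesis
      using acyclic_paths that by (fastforce simp: apath_def awalk_def)
  qed
  have summand: "((\<lambda>x. ?D $ l $ i * \<tau> l ((?D *v x) $ l)) has_derivative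
      (\<lambda>v. ?D $ l $ i * (\<tau>' l ((?D *v h) $ l) * (?D *v v) $ l))) (at h within ?S)" for l i
  proof (cases "l \<in> arcs G")
    case True
    have lin: "((\<lambda>x. (?D *v x) $ l) has_derivative (\<lambda>v. (?D *v v) $ l)) (at h within ?S)"
      by (intro bounded_linear_imp_has_derivative
          bounded_linear_compose[OF bounded_linear_vec_nth matrix_vector_mul_bounded_linear])
    have "(\<tau> l has_derivative (\<lambda>x. \<tau>' l ((?D *v h) $ l) * x)) (at ((?D *v h) $ l) within {0..})"
      using link_cost_deriv[OF True nonneg, of h] h by (simp add: has_field_derivative_def)
    then have "(\<tau> l has_derivative (\<lambda>x. \<tau>' l ((?D *v h) $ l) * x))
        (at ((?D *v h) $ l) within (\<lambda>x. (?D *v x) $ l) ` ?S)"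
      by (rule has_derivative_subset) (use nonneg in auto)
    from has_derivative_in_compose[OF lin this] show ?thesis
      by (intro has_derivative_mult_right)
  next
    case False
    then have "?D $ l $ i = 0"
      using link by (auto simp: incidence_def)
    then show ?thesis by simp
  qed
  have *: "((\<lambda>x. path_cost route \<tau> x $ i) has_derivative
      (\<lambda>v. (path_cost_jacobian route \<tau>' h *v v) $ i)) (at h within ?S)" for i
  proof -
    have 1: "path_cost route \<tau> x $ i = (\<Sum>l\<in>UNIV. ?D $ l $ i * \<tau> l ((?D *v x) $ l))" for x
      by (simp add: path_cost_def link_cost_def matrix_vector_mult_def transpose_def)
    have 2: "(path_cost_jacobian route \<tau>' h *v v) $ i
        = (\<Sum>l\<in>UNIV. ?D $ l $ i * (\<tau>' l ((?D *v h) $ l) * (?D *v v) $ l))" for v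
    proof -
      let ?E = "(\<chi> k l. if k = l then \<tau>' l ((?D *v h) $ l) else 0) :: real^'l^'l"
      have E: "(?E *v w) $ k = \<tau>' k ((?D *v h) $ k) * w $ k" for w k
        by (simp add: matrix_vector_mult_def if_distrib[of "\<lambda>x. x * _"] cong: if_cong)
      have T: "(transpose ?D *v w) $ i = (\<Sum>l\<in>UNIV. ?D $ l $ i * w $ l)" for w
        by (simp add: matrix_vector_mult_def transpose_def)
      have "path_cost_jacobian route \<tau>' h *v v = transpose ?D *v (?E *v (?D *v v))"
        unfolding path_cost_jacobian_def matrix_vector_mul_assoc[symmetric] ..
      then show ?thesis by (simp only: T E)
    qed
    show ?thesis
      unfolding 1 2 by (intro has_derivative_sum summand)
  qed
  show ?thesis
    by (subst has_derivative_componentwise_within) (auto simp: Basis_vec_def inner_axis *)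
qed

end

theory Submission
  imports Defs
begin

text \<open>
  A solution of the reduced system sums to zero over each OD pair: \<open>\<L>(h) - h\<close> has this property
  because \<open>\<L>\<close> preserves the demands, and so does the range of \<open>\<K>(h)\<close> because the
  probabilities of an OD pair sum to a constant and the demand is the same for all its paths. The
  matrix \<open>\<H>'\<^sub>h(p)\<close> only sees these sums, so its contribution to the full system vanishes.
\<close>

lemma sum_logit_prob:
  fixes od :: "'p::finite \<Rightarrow> 'w"
  shows "(\<Sum>j | od j = od i. logit_prob od \<theta> c $ j) = 1"
proof -
  \<comment> \<open>The index set contains \<open>i\<close> itself, so this is a nonempty sum of
    exponentials.\<close>
  have pos: "0 < (\<Sum>k | od k = od i. exp (- \<theta> * c $ k))"
    by (rule sum_pos) auto
  have "(\<Sum>j | od j = od i. logit_prob od \<theta> c $ j)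
      = (\<Sum>j | od j = od i. exp (- \<theta> * c $ j) / (\<Sum>k | od k = od i. exp (- \<theta> * c $ k)))"
    by (rule sum.cong) (auto simp: logit_prob_def)
  also have "\<dots> = 1"
    using pos unfolding sum_divide_distrib[symmetric] by simp
  finally show ?thesis .
qed

text \<open>The probabilities of one OD pair sum to the constant 1 for every cost vector, so
  differentiating this identity in any direction \<open>v\<close> gives 0.\<close>

lemma sum_logit_prob_jacobian:
  fixes od :: "'p::finite \<Rightarrow> 'w"
  shows "(\<Sum>j | od j = od i. (jacobian (logit_prob od \<theta>) (at c) *v v) $ j) = 0"
proof -
  let ?J = "jacobian (logit_prob od \<theta>) (at c)"
  have "(logit_prob od \<theta> has_derivative (\<lambda>v. ?J *v v)) (at c)"
    using logit_prob_differentiable jacobian_works by blast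
  then have "((\<lambda>x. \<Sum>j | od j = od i. logit_prob od \<theta> x $ j) has_derivative
      (\<lambda>v. \<Sum>j | od j = od i. (?J *v v) $ j)) (at c)"
    by (intro has_derivative_sum bounded_linear.has_derivative[OF bounded_linear_vec_nth])
  then have "((\<lambda>x. 1) has_derivative (\<lambda>v. \<Sum>j | od j = od i. (?J *v v) $ j)) (at c)"
    by (simp only: sum_logit_prob)
  from has_derivative_unique[OF this has_derivative_const] show ?thesis
    by (simp add: fun_eq_iff)
qed

text \<open>The outer factor of the reduced Jacobian is diagonal with entry \<open>d (od j)\<close>,
  which is the same for all paths of one pair. It leaves the sum, and what remains is a directional
  derivative of the probabilities.\<close>

lemma sum_reduced_jacobian:
  fixes od :: "'p::finite \<Rightarrow> 'v \<times> 'v"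
  assumes h: "h \<in> feasible_flows W od d" and od: "range od \<subseteq> W"
  shows "(\<Sum>j | od j = od i. (reduced_jacobian od route \<tau> \<tau>' \<theta> h *v v) $ j) = 0"
proof -
  let ?w = "jacobian (logit_prob od \<theta>) (at (path_cost route \<tau> h)) *v
    (path_cost_jacobian route \<tau>' h *v v)"
  have "(reduced_jacobian od route \<tau> \<tau>' \<theta> h *v v) $ j = d (od j) * ?w $ j" for j
    unfolding reduced_jacobian_def Let_def matrix_vector_mul_assoc[symmetric]
      assignment_jacobian_prob_entries[OF h od]
    by (subst matrix_vector_mult_def)
       (simp add: if_distrib[of "\<lambda>x. x * _"] cong: if_cong)
  then have "(\<Sum>j | od j = od i. (reduced_jacobian od route \<tau> \<tau>' \<theta> h *v v) $ j)
      = d (od i) * (\<Sum>j | od j = od i. ?w $ j)"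
    by (simp add: sum_distrib_left)
  then show ?thesis
    by (simp only: sum_logit_prob_jacobian mult_zero_right)
qed

lemma sum_logit_map:
  fixes od :: "'p::finite \<Rightarrow> 'w"
  shows "(\<Sum>j | od j = od i. logit_map od route \<tau> \<theta> h $ j) = (\<Sum>j | od j = od i. h $ j)"
proof -
  let ?p = "logit_prob od \<theta> (path_cost route \<tau> h)"
  have "(\<Sum>j | od j = od i. logit_map od route \<tau> \<theta> h $ j)
      = (\<Sum>j | od j = od i. (\<Sum>k | od k = od i. h $ k) * ?p $ j)"
    by (rule sum.cong) (auto simp: logit_map_def assignment_def)
  then show ?thesis
    by (simp only: sum_distrib_left[symmetric] sum_logit_prob mult_1_right)
qed

text \<open>Makes visible that this Jacobian annihilates every vector whose sum over each OD pair is
  zero.\<close>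

lemma assignment_jacobian_flow_mult:
  fixes od :: "'p::finite \<Rightarrow> 'w"
  shows "(assignment_jacobian_flow od h p *v v) $ i = p $ i * (\<Sum>j | od j = od i. v $ j)"
  unfolding assignment_jacobian_flow_entries matrix_vector_mult_def sum_distrib_left vec_lambda_beta
  by (rule sum.mono_neutral_cong_right) auto

theorem theorem4:
  fixes G :: "('v, 'l::finite) pre_digraph"
    and W :: "('v \<times> 'v) set"
    and paths :: "'v \<times> 'v \<Rightarrow> 'l list set"
    and od :: "'p::finite \<Rightarrow> 'v \<times> 'v"
    and route :: "'p \<Rightarrow> 'l list"
    and d :: "'v \<times> 'v \<Rightarrow> real"
    and \<tau> \<tau>' :: "'l \<Rightarrow> real \<Rightarrow> real"
    and \<theta> :: real
    and h \<delta> :: "real ^ 'p"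
  assumes network: "traffic_network G W paths od route d \<tau> \<tau>'"
    and theta: "\<theta> > 0"
    and feasible: "h \<in> feasible_flows W od d"
    and reduced_newton:
      "(mat 1 - reduced_jacobian od route \<tau> \<tau>' \<theta> h) *v \<delta> = logit_map od route \<tau> \<theta> h - h"
  shows "(assignment_jacobian_flow od h (logit_prob od \<theta> (path_cost route \<tau> h))
            + reduced_jacobian od route \<tau> \<tau>' \<theta> h - mat 1) *v \<delta>
         = - (logit_map od route \<tau> \<theta> h - h)"
proof -
  let ?K = "reduced_jacobian od route \<tau> \<tau>' \<theta> h"
  \<comment> \<open>Places every \<open>od i\<close> in \<open>W\<close>, where the demand
    constraints of \<open>feasible\<close> are imposed.\<close>
  have od: "range od \<subseteq> W"
    using traffic_network.enumeration[OF network] by (auto simp: bij_betw_def)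
  \<comment> \<open>The reduced system is read as a fixed-point equation whose right-hand side
    consists of terms with vanishing OD sums.\<close>
  have \<delta>: "\<delta> = ?K *v \<delta> + (logit_map od route \<tau> \<theta> h - h)"
    using reduced_newton by (simp add: matrix_vector_mult_diff_rdistrib algebra_simps)
  have "(\<Sum>j | od j = od i. \<delta> $ j) = 0" for i
    by (subst \<delta>) (simp add: sum.distrib sum_subtractf sum_logit_map
        sum_reduced_jacobian[OF feasible od])
  then have "assignment_jacobian_flow od h p *v \<delta> = 0" for p
    by (simp add: vec_eq_iff assignment_jacobian_flow_mult)
  \<comment> \<open>Without the flow Jacobian term, the full system is the reduced one with both
    sides negated.\<close>
  then show ?thesis
    using reduced_newton
    by (simp add: matrix_vector_mult_diff_rdistrib matrix_vector_mult_add_rdistrib algebra_simps)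
qed

end
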